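(* Fix $m\ge1$ and machine speeds $s_1\ge s_2\ge\cdots\ge s_m>0$, and write $\frac{\sum_{i=1}^m s_i}{s_1}=t+\Delta$ with $t$ an integer, $1\le t\le m$, and $0\le\Delta<1$; set $s_{m+1}=0$. Then for the fractional problem on related machines with these speeds, $$WAR(Qm(FP))=\frac{\sum_{i=1}^m s_i}{\sum_{i=1}^t s_i+\Delta s_{t+1}}.$$ Moreover, if the machine speeds are part of the input (i.e. the supremum defining $WAR$ is taken over all speed vectors as well as all job sets, with $m$ fixed), then $WAR(Qm(FP))=\frac{\sqrt{m}+1}{2}$.
   Context: Related machines: machines $M_1,\dots,M_m$ with speeds $s_i>0$; jobs $J_1,\dots,J_n$ with standard processing times $p_j>0$; processing $J_j$ entirely on $M_i$ takes time $p_j/s_i$. $Qm(FP)$ is the fractional problem: each job may be partitioned into parts processed on different machines, even concurrently; each machine processes at most one job at a time; schedules start at time $0$. For a feasible schedule $S$, the load $L^S_i$ of $M_i$ is the time by which $M_i$ finishes all processing assigned to it, $L(S)=(L^S_1,\dots,L^S_m)$. For $X\in\mathbb{R}^m$ let $\overleftarrow{X}$ be $X$ sorted in non-increasing order and $\sigma(X)$ its prefix-sum vector; $X\preceq_s Y$ means $\sigma(\overleftarrow{X})\le\sigma(\overleftarrow{Y})$ coordinatewise. For an instance $\mathcal{I}$ with feasible schedules $\mathcal{S}$ and $S\in\mathcal{S}$, $s(S)$ is the infimum of $\alpha$ with $L(S)\preceq_s\alpha L(T)$ for all $T\in\mathcal{S}$, and $s^*(\mathcal{I})=\inf_{S\in\mathcal{S}}s(S)$.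 $WAR(\mathcal{P})=\sup_{\mathcal{I}}s^*(\mathcal{I})$, the supremum over all instances of the problem (for fixed speeds: over all job sets on machines with the given speeds). *)

theory Defs
  imports Complex_Main "HOL-Library.Extended_Real"
begin

definition sort_desc :: "real list \<Rightarrow> real list" where
  "sort_desc X = rev (sort X)"

definition prefix_sums :: "real list \<Rightarrow> real list" where
  "prefix_sums X = map (\<lambda>k. sum_list (take k X)) [1..<Suc (length X)]"

definition submajorized :: "real list \<Rightarrow> real list \<Rightarrow> bool" (infix "\<preceq>\<^sub>s" 50) where
  "X \<preceq>\<^sub>s Y \<longleftrightarrow> list_all2 (\<le>) (prefix_sums (sort_desc X)) (prefix_sums (sort_desc Y))"

text \<open>Machines are numbered from 1 to \<open>m\<close> and jobs from 1 to \<open>n\<close>; the speeds \<open>s\<close> and the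
  standard processing times \<open>p\<close> are functions of which only the values at these indices matter.
  A part of a job occupies its machine during the half-open time interval from \<open>start\<close> to
  \<open>finish\<close>. Idle time is allowed, and so is the concurrent processing of parts of one job on
  different machines.\<close>

record part =
  machine :: nat
  job :: nat
  start :: real
  finish :: real

definition feasible_schedules ::
    "nat \<Rightarrow> (nat \<Rightarrow> real) \<Rightarrow> nat \<Rightarrow> (nat \<Rightarrow> real) \<Rightarrow> part set set" where
  "feasible_schedules m s n p = {S. finite S \<and>
     (\<forall>x\<in>S. machine x \<in> {1..m} \<and> job x \<in> {1..n} \<and> 0 \<le> start x \<and> start x < finish x) \<and>
     (\<forall>x\<in>S. \<forall>y\<in>S. x \<noteq> y \<and> machine x = machine y \<longrightarrow>
        {start x..<finish x} \<inter> {start y..<finish y} = {}) \<and>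
     (\<forall>j\<in>{1..n}. (\<Sum>x | x \<in> S \<and> job x = j. s (machine x) * (finish x - start x)) = p j)}"

text \<open>A machine that processes nothing has load 0.\<close>

definition load :: "part set \<Rightarrow> nat \<Rightarrow> real" where
  "load S i = Max (insert 0 (finish ` {x \<in> S. machine x = i}))"

definition loads :: "nat \<Rightarrow> part set \<Rightarrow> real list" where
  "loads m S = map (load S) [1..<Suc m]"

text \<open>Infima and suprema are taken in the extended reals, so that they are meaningful without a
  separate proof of nonemptiness or boundedness.\<close>

definition schedule_ratio ::
    "nat \<Rightarrow> (nat \<Rightarrow> real) \<Rightarrow> nat \<Rightarrow> (nat \<Rightarrow> real) \<Rightarrow> part set \<Rightarrow> ereal" where
  "schedule_ratio m s n p S =
     Inf {ereal \<alpha> |\<alpha>. \<forall>T\<in>feasible_schedules m s n p. loads m S \<preceq>\<^sub>s map ((*) \<alpha>) (loads m T)}"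

definition instance_ratio ::
    "nat \<Rightarrow> (nat \<Rightarrow> real) \<Rightarrow> nat \<Rightarrow> (nat \<Rightarrow> real) \<Rightarrow> ereal" where
  "instance_ratio m s n p = (INF S\<in>feasible_schedules m s n p. schedule_ratio m s n p S)"

definition job_sets :: "(nat \<times> (nat \<Rightarrow> real)) set" where
  "job_sets = {(n, p). 1 \<le> n \<and> (\<forall>j\<in>{1..n}. 0 < p j)}"

definition speed_vectors :: "nat \<Rightarrow> (nat \<Rightarrow> real) set" where
  "speed_vectors m = {s. \<forall>i\<in>{1..m}. 0 < s i}"

text \<open>The set \<open>V\<close> contains the admissible speed vectors: a singleton for fixed speeds,
  \<open>speed_vectors m\<close> if the speeds are part of the input.\<close>

definition WAR :: "nat \<Rightarrow> (nat \<Rightarrow> real) set \<Rightarrow> ereal" where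
  "WAR m V = (SUP (s, n, p)\<in>V \<times> job_sets. instance_ratio m s n p)"

end

theory Submission imports Defs "HOL-Library.Multiset" begin

text \<open>Let \<open>P\<close> be the total processing time, \<open>\<Sigma>\<close> the sum of the speeds and \<open>M\<close> the largest
  speed. A load vector \<open>L \<ge> 0\<close> with \<open>\<Sum>i. s i * L i = P\<close> is always attained, by splitting every job
  over the machines in the same proportion, and every schedule has \<open>\<Sum>i. s i * L i \<ge> P\<close>. The sum of
  the \<open>k\<close> largest loads is therefore at least \<open>min (P / M) (k * P / \<Sigma>)\<close>; the two values come from
  running only the fastest machine and from balancing all loads. Hence a schedule with ratio \<open>\<rho>\<close> is
  one whose loads are at most \<open>c = \<rho> * P / \<Sigma>\<close> each and at most \<open>c * \<Sigma> / M\<close> together, and the best \<open>\<rho>\<close>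
  is the value of a fractional knapsack problem, which fills the fastest machines first.
  If the speeds vary, loads proportional to the speeds are good enough: for \<open>M = 1\<close> the tangents
  \<open>x\<^sup>2 \<ge> 2 * a * x - a\<^sup>2\<close> at \<open>a = 1 / (sqrt m + 1)\<close> give \<open>\<Sum>i. (s i)\<^sup>2 \<ge> 2 * a * \<Sigma>\<close>, and the speeds
  \<open>1, a, \<dots>, a\<close> are the worst case.\<close>

section \<open>Sums of the largest entries\<close>

abbreviation top_sum :: "nat \<Rightarrow> real list \<Rightarrow> real" where
  "top_sum k X \<equiv> sum_list (take k (sort_desc X))"

lemma length_sort_desc [simp]: "length (sort_desc X) = length X"
  and set_sort_desc [simp]: "set (sort_desc X) = set X"
  and mset_sort_desc [simp]: "mset (sort_desc X) = mset X"
  by (simp_all add: sort_desc_def)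

lemma sum_list_map_sort_desc: "sum_list (map f (sort_desc X)) = sum_list (map f X)"
  for f :: "real \<Rightarrow> real"
  by (metis mset_sort_desc mset_map sum_mset_sum_list)

lemma sort_desc_nth_mono:
  assumes "i \<le> j" "j < length X"
  shows "sort_desc X ! j \<le> sort_desc X ! i"
  using assms unfolding sort_desc_def
  by (auto simp: rev_nth intro!: sorted_nth_mono)

lemma submajorized_iff:
  assumes "length X = length Y"
  shows "X \<preceq>\<^sub>s Y \<longleftrightarrow> (\<forall>k\<in>{1..length X}. top_sum k X \<le> top_sum k Y)"
proof -
  have "X \<preceq>\<^sub>s Y \<longleftrightarrow> list_all (\<lambda>k. top_sum k X \<le> top_sum k Y) [1..<Suc (length X)]"
    unfolding submajorized_def prefix_sums_def using assms
    by (simp add: list_all2_map1 list_all2_map2 list_all2_same list_all_iff del: upt_Suc)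
  then show ?thesis by (auto simp: list_all_iff simp del: upt_Suc)
qed

lemma top_sum_length: "top_sum (length X) X = sum_list X"
  using sum_list_map_sort_desc[of id X] by simp

lemma top_sum_le_bound:
  assumes "\<forall>x\<in>set X. x \<le> c" "k \<le> length X"
  shows "top_sum k X \<le> real k * c"
proof -
  have "sum_list (map id (take k (sort_desc X))) \<le> sum_list (map (\<lambda>_. c) (take k (sort_desc X)))"
    using assms by (intro sum_list_mono) (auto dest: in_set_takeD)
  then show ?thesis
    using assms by (simp add: sum_list_triv)
qed

lemma top_sum_le_sum_list:
  assumes "\<forall>x\<in>set X. 0 \<le> x"
  shows "top_sum k X \<le> sum_list X"
proof -
  have "sum_list X = top_sum k X + sum_list (drop k (sort_desc X))"
    using sum_list_map_sort_desc[of id X] by (simp flip: sum_list_append)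
  moreover have "0 \<le> sum_list (drop k (sort_desc X))"
    using assms by (intro sum_list_nonneg) (auto dest: in_set_dropD)
  ultimately show ?thesis by simp
qed

lemma le_top_sum_1:
  assumes "x \<in> set X"
  shows "x \<le> top_sum 1 X"
proof -
  obtain i where i: "i < length X" "x = sort_desc X ! i"
    using assms by (metis in_set_conv_nth length_sort_desc set_sort_desc)
  then have "x \<le> sort_desc X ! 0" using sort_desc_nth_mono[of 0 i X] by simp
  moreover have "top_sum 1 X = sort_desc X ! 0"
    using i by (cases "sort_desc X") (auto dest: arg_cong[of _ _ length])
  ultimately show ?thesis by simp
qed

text \<open>In sorted order the first \<open>k\<close> entries are at least the \<open>k\<close>-th
  largest entry \<open>x\<close> and the rest at most \<open>x\<close>, so the positive excess over
  \<open>x\<close> comes from the first \<open>k\<close> alone. The sum on the right runs over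
  \<open>X\<close> in its own order and can be taken machine by machine.\<close>

lemma top_sum_eq_excess:
  assumes "1 \<le> k" "k \<le> length X"
  defines "x \<equiv> sort_desc X ! (k - 1)"
  shows "top_sum k X = real k * x + (\<Sum>y\<leftarrow>X. max 0 (y - x))"
proof -
  let ?D = "sort_desc X" and ?f = "\<lambda>y. max 0 (y - x)"
  have "y \<ge> x" if "y \<in> set (take k ?D)" for y
    using that assms sort_desc_nth_mono[of _ "k - 1" X]
    by (force simp: in_set_conv_nth)
  then have "sum_list (map ?f (take k ?D)) = sum_list (map (\<lambda>y. y - x) (take k ?D))"
    by (intro arg_cong[of _ _ sum_list] map_cong) auto
  also have "\<dots> = top_sum k X - real k * x"
    using assms by (simp add: sum_list_subtractf sum_list_triv)
  finally have 1: "sum_list (map ?f (take k ?D)) = top_sum k X - real k * x" .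
  have "y \<le> x" if "y \<in> set (drop k ?D)" for y
    using that assms sort_desc_nth_mono[of "k - 1" _ X]
    by (force simp: in_set_conv_nth)
  then have "sum_list (map ?f (drop k ?D)) = sum_list (map (\<lambda>y. 0) (drop k ?D))"
    by (intro arg_cong[of _ _ sum_list] map_cong) auto
  then have 2: "sum_list (map ?f (drop k ?D)) = 0" by simp
  have "sum_list (map ?f X) = sum_list (map ?f (take k ?D @ drop k ?D))"
    by (simp only: append_take_drop_id sum_list_map_sort_desc)
  also have "\<dots> = top_sum k X - real k * x" by (simp only: map_append sum_list_append 1 2)
  finally show ?thesis by simp
qed

lemma sum_list_map_upt: "sum_list (map f [1..<Suc m]) = (\<Sum>i=1..m. f i)" for f :: "nat \<Rightarrow> real"
  by (simp add: interv_sum_list_conv_sum_set_nat atLeastLessThanSuc_atLeastAtMost del: upt_Suc)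

text \<open>Each \<open>L i\<close> is at most a threshold plus its excess over it. The threshold
  carries the sum of all speeds as weight, each excess a weight of at most \<open>M\<close>, and the
  top sum consists of the same two parts. Applied to the loads of an arbitrary schedule, this bounds
  the sum of its \<open>k\<close> largest loads from below.\<close>

lemma weighted_sum_le_top_sum:
  fixes s L :: "nat \<Rightarrow> real"
  assumes k: "1 \<le> k" "k \<le> m"
    and s: "\<And>i. i \<in> {1..m} \<Longrightarrow> 0 \<le> s i \<and> s i \<le> M"
    and L: "\<And>i. i \<in> {1..m} \<Longrightarrow> 0 \<le> L i"
  shows "(\<Sum>i=1..m. s i * L i) \<le>
    top_sum k (map L [1..<Suc m]) * max ((\<Sum>i=1..m. s i) / real k) M"
proof -
  let ?X = "map L [1..<Suc m]"
  define x where "x = sort_desc ?X ! (k - 1)"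
  define A where "A = top_sum k ?X"
  define E where "E = (\<Sum>i=1..m. max 0 (L i - x))"
  define K where "K = max ((\<Sum>i=1..m. s i) / real k) M"
  have "x \<in> set (sort_desc ?X)"
    unfolding x_def using k by (intro nth_mem) simp
  then have x: "0 \<le> x" using L by auto
  have A: "A = real k * x + E"
    using top_sum_eq_excess[of k ?X] k
    unfolding A_def E_def x_def sum_list_map_upt[symmetric] map_map comp_def by simp
  have E: "0 \<le> E" unfolding E_def by (intro sum_nonneg) auto
  have "(\<Sum>i=1..m. s i * L i) \<le> (\<Sum>i=1..m. s i * x + M * max 0 (L i - x))"
  proof (rule sum_mono)
    fix i assume i: "i \<in> {1..m}"
    have "s i * L i \<le> s i * (x + max 0 (L i - x))"
      using s[OF i] by (intro mult_left_mono) auto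
    also have "\<dots> \<le> s i * x + M * max 0 (L i - x)"
      using s[OF i] by (auto simp: algebra_simps intro!: mult_right_mono)
    finally show "s i * L i \<le> s i * x + M * max 0 (L i - x)" .
  qed
  \<comment> \<open>The factor \<open>real k\<close> is inserted to match
    \<open>A = real k * x + E\<close>, so that \<open>K\<close> dominates both coefficients.\<close>
  also have "\<dots> = (\<Sum>i=1..m. s i) / real k * (real k * x) + M * E"
    using k by (simp add: sum.distrib sum_distrib_left[symmetric] sum_distrib_right[symmetric] E_def)
  also have "\<dots> \<le> K * (real k * x) + K * E"
    using x E unfolding K_def by (intro add_mono mult_right_mono) auto
  also have "\<dots> = A * K" unfolding A by (simp add: algebra_simps)
  finally show ?thesis unfolding A_def K_def .
qed

section \<open>Loads of feasible schedules\<close>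

lemma finish_le_load:
  assumes "finite S" "x \<in> S" "machine x = i"
  shows "finish x \<le> load S i"
  using assms unfolding load_def by (intro Max_ge) auto

lemma load_nonneg: "finite S \<Longrightarrow> 0 \<le> load S i"
  unfolding load_def by (intro Max_ge) auto

text \<open>All other intervals must end by the start \<open>a x\<close> of one with the latest end.
  By induction, with \<open>a x\<close> in the role of \<open>B\<close>, they have total length at
  most \<open>a x\<close>.\<close>

lemma sum_disjoint_lengths_le:
  fixes a b :: "'a \<Rightarrow> real"
  assumes "finite A" "\<forall>x\<in>A. 0 \<le> a x \<and> a x < b x \<and> b x \<le> B" "0 \<le> B"
    "\<forall>x\<in>A. \<forall>y\<in>A. x \<noteq> y \<longrightarrow> {a x..<b x} \<inter> {a y..<b y} = {}"
  shows "(\<Sum>x\<in>A. b x - a x) \<le> B"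
  using assms
proof (induction A arbitrary: B rule: finite_ranking_induct[where f = b])
  case empty
  then show ?case by simp
next
  case (insert x A)
  \<comment> \<open>The ranking induction may insert an element that is already present; then the
    claim is the induction hypothesis.\<close>
  show ?case
  proof (cases "x \<in> A")
    case True
    then show ?thesis using insert by (simp add: insert_absorb)
  next
    case False
    have "b y \<le> a x" if "y \<in> A" for y
    proof (rule ccontr)
      assume "\<not> b y \<le> a x"
      \<comment> \<open>The later of the two starts would lie in both intervals, as
        \<open>b y \<le> b x\<close>.\<close>
      then have "max (a x) (a y) \<in> {a x..<b x} \<inter> {a y..<b y}"
        using that insert.hyps insert.prems(1) by fastforce
      moreover have "x \<noteq> y" using that False by auto
      ultimately show False using insert.prems(3) that by blast
    qed
    with insert.prems have "(\<Sum>x\<in>A. b x - a x) \<le> a x" by (intro insert.IH) blast+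
    moreover have "b x \<le> B" using insert.prems by blast
    ultimately show ?thesis using False insert.hyps by simp
  qed
qed

text \<open>The work is counted by job and regrouped by machine. On each machine the disjoint parts
  fit between time 0 and the load; idle time accounts for any gap in the inequality.\<close>

lemma work_le_loads:
  assumes S: "S \<in> feasible_schedules m s n p" and s: "s \<in> speed_vectors m"
  shows "(\<Sum>j=1..n. p j) \<le> (\<Sum>i=1..m. s i * load S i)"
proof -
  from S have fin: "finite S"
    and parts: "\<forall>x\<in>S. machine x \<in> {1..m} \<and> job x \<in> {1..n} \<and> 0 \<le> start x \<and> start x < finish x"
    and disj: "\<forall>x\<in>S. \<forall>y\<in>S. x \<noteq> y \<and> machine x = machine y \<longrightarrow>
        {start x..<finish x} \<inter> {start y..<finish y} = {}"
    and jobs: "\<forall>j\<in>{1..n}. (\<Sum>x | x \<in> S \<and> job x = j. s (machine x) * (finish x - start x)) = p j"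
    unfolding feasible_schedules_def by auto
  have "(\<Sum>j=1..n. p j) = (\<Sum>j=1..n. \<Sum>x | x \<in> S \<and> job x = j. s (machine x) * (finish x - start x))"
    using jobs by (intro sum.cong) auto
  also have "\<dots> = (\<Sum>x\<in>S. s (machine x) * (finish x - start x))"
    using fin parts by (intro sum.group) auto
  also have "\<dots> = (\<Sum>i=1..m. \<Sum>x | x \<in> S \<and> machine x = i. s (machine x) * (finish x - start x))"
    using fin parts by (intro sum.group[symmetric]) auto
  also have "\<dots> = (\<Sum>i=1..m. s i * (\<Sum>x | x \<in> S \<and> machine x = i. finish x - start x))"
    by (auto simp: sum_distrib_left intro!: sum.cong)
  also have "\<dots> \<le> (\<Sum>i=1..m. s i * load S i)"
  proof (rule sum_mono)
    fix i assume "i \<in> {1..m}"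
    moreover have "(\<Sum>x | x \<in> S \<and> machine x = i. finish x - start x) \<le> load S i"
      using fin parts disj
      by (intro sum_disjoint_lengths_le) (auto intro: finish_le_load load_nonneg)
    ultimately show "s i * (\<Sum>x | x \<in> S \<and> machine x = i. finish x - start x) \<le> s i * load S i"
      using s by (intro mult_left_mono) (auto simp: speed_vectors_def less_imp_le)
  qed
  finally show ?thesis .
qed

lemma job_sets_total_pos: "(n, p) \<in> job_sets \<Longrightarrow> 0 < (\<Sum>j=1..n. p j)"
  unfolding job_sets_def by (auto intro!: sum_pos)

text \<open>Every machine divides its load among all jobs in the proportions \<open>p j / P\<close>,
  so job \<open>j\<close> receives the work \<open>P * (p j / P) = p j\<close>. The choice of a
  schedule thus reduces to the choice of a load vector.\<close>

lemma exists_schedule_with_loads: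
  fixes L :: "nat \<Rightarrow> real"
  assumes np: "(n, p) \<in> job_sets"
    and L: "\<And>i. i \<in> {1..m} \<Longrightarrow> 0 \<le> L i"
    and work: "(\<Sum>i=1..m. s i * L i) = (\<Sum>j=1..n. p j)"
  obtains S where "S \<in> feasible_schedules m s n p" "loads m S = map L [1..<Suc m]"
proof -
  define Q where "Q j = (\<Sum>l=1..j. p l)" for j
  define P where "P = Q n"
  have P: "0 < P" using job_sets_total_pos[OF np] by (simp add: P_def Q_def)
  have n: "1 \<le> n" and p: "\<And>j. j \<in> {1..n} \<Longrightarrow> 0 < p j"
    using np unfolding job_sets_def by auto
  have Qstep: "Q j = Q (j - 1) + p j" if "j \<in> {1..n}" for j
    using that unfolding Q_def by (cases j) auto
  have Qmono: "Q i \<le> Q j" if "i \<le> j" "j \<le> n" for i j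
    unfolding Q_def using that p by (intro sum_mono2) (auto simp: less_imp_le)
  have Q0: "0 \<le> Q j" if "j \<le> n" for j using Qmono[of 0 j] that by (simp add: Q_def)
  \<comment> \<open>Parts must have positive length, so a machine of load 0 gets none.\<close>
  define I where "I = {i \<in> {1..m}. 0 < L i} \<times> {1..n}"
  \<comment> \<open>Machine \<open>i\<close> runs the jobs in order without idle time; the cuts are
    the prefix sums \<open>Q j\<close>, rescaled to send \<open>P\<close> to
    \<open>L i\<close>.\<close>
  define g where "g = (\<lambda>(i, j). \<lparr>machine = i, job = j,
    start = L i * Q (j - 1) / P, finish = L i * Q j / P\<rparr>)"
  define S where "S = g ` I"
  have fin: "finite S" unfolding S_def I_def by auto
  have disj: "{start x..<finish x} \<inter> {start y..<finish y} = {}"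
    if xy: "x \<in> S" "y \<in> S" "machine x = machine y" "job x < job y" for x y
  proof -
    obtain i j i' j' where x: "x = g (i, j)" and y: "y = g (i', j')"
      and I: "(i, j) \<in> I" "(i', j') \<in> I"
      using xy(1,2) unfolding S_def by auto
    then have [simp]: "i' = i" using xy(3) by (simp add: g_def)
    have "L i * Q j / P \<le> L i * Q (j' - 1) / P"
      using xy(4) x y I P
      by (intro divide_right_mono mult_left_mono Qmono) (auto simp: g_def I_def)
    then show ?thesis unfolding x y g_def by auto
  qed
  have job_work: "(\<Sum>x | x \<in> S \<and> job x = j. s (machine x) * (finish x - start x)) = p j"
    if j: "j \<in> {1..n}" for j
  proof -
    have "{x. x \<in> S \<and> job x = j} = (\<lambda>i. g (i, j)) ` {i \<in> {1..m}. 0 < L i}"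
      unfolding S_def I_def g_def using j by (auto simp: image_iff)
    then have "(\<Sum>x | x \<in> S \<and> job x = j. s (machine x) * (finish x - start x)) =
      (\<Sum>i | i \<in> {1..m} \<and> 0 < L i. s i * (L i * Q j / P - L i * Q (j - 1) / P))"
      by (simp only:) (subst sum.reindex, auto simp: inj_on_def g_def)
    also have "\<dots> = (\<Sum>i | i \<in> {1..m} \<and> 0 < L i. s i * L i * (p j / P))"
      using Qstep[OF j] by (intro sum.cong) (auto simp: algebra_simps add_divide_distrib)
    also have "\<dots> = (\<Sum>i=1..m. s i * L i * (p j / P))"
      using L by (intro sum.mono_neutral_left) (auto simp: less_le)
    also have "\<dots> = P * (p j / P)"
      unfolding sum_distrib_right[symmetric] work by (simp add: P_def Q_def)
    finally show ?thesis using P by simp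
  qed
  have "S \<in> feasible_schedules m s n p"
    unfolding feasible_schedules_def
  proof (intro CollectI conjI ballI impI fin job_work)
    fix x assume "x \<in> S"
    then obtain i j where x: "x = g (i, j)" and I: "i \<in> {1..m}" "0 < L i" "j \<in> {1..n}"
      unfolding S_def I_def by auto
    show "machine x \<in> {1..m}" "job x \<in> {1..n}" using x I unfolding g_def by auto
    show "0 \<le> start x" using x I P Q0[of "j - 1"] unfolding g_def by auto
    show "start x < finish x"
      using x I P p[of j] Qstep[of j] unfolding g_def by (auto intro!: divide_strict_right_mono)
  next
    fix x y assume xy: "x \<in> S" "y \<in> S" "x \<noteq> y \<and> machine x = machine y"
    then have "job x \<noteq> job y" unfolding S_def g_def by auto
    then consider "job x < job y" | "job y < job x" by linarith
    then show "{start x..<finish x} \<inter> {start y..<finish y} = {}"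
      using disj[of x y] disj[of y x] xy by cases auto
  qed
  moreover have "load S i = L i" if i: "i \<in> {1..m}" for i
  proof (cases "0 < L i")
    case True
    \<comment> \<open>The part of the last job ends at \<open>L i\<close>, because
      \<open>Q n = P\<close>.\<close>
    have "g (i, n) \<in> S" unfolding S_def I_def using i n True by auto
    then have "finish (g (i, n)) \<in> finish ` {x \<in> S. machine x = i}"
      by (intro imageI) (auto simp: g_def)
    then have mem: "L i \<in> finish ` {x \<in> S. machine x = i}"
      using P unfolding g_def P_def by simp
    have "finish x \<le> L i" if "x \<in> S" "machine x = i" for x
    proof -
      obtain j where x: "x = g (i, j)" "j \<le> n" using \<open>x \<in> S\<close> \<open>machine x = i\<close>
        unfolding S_def I_def g_def by auto
      have "L i * Q j \<le> L i * P" unfolding P_def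
        using Qmono[of j n] x True by (intro mult_left_mono) auto
      then show ?thesis using P x unfolding g_def by (simp add: divide_le_eq)
    qed
    then show ?thesis unfolding load_def
      using mem fin True by (intro Max_eqI) auto
  next
    case False
    then have "{x \<in> S. machine x = i} = {}" unfolding S_def I_def g_def by auto
    then have "load S i = 0" unfolding load_def by (simp only: image_empty Max_singleton)
    then show ?thesis using False L[OF i] by simp
  qed
  then have "loads m S = map L [1..<Suc m]" unfolding loads_def by auto
  ultimately show ?thesis using that by blast
qed

section \<open>The ratio of an instance\<close>

lemma speed_sum_pos: "s \<in> speed_vectors m \<Longrightarrow> 1 \<le> m \<Longrightarrow> 0 < (\<Sum>i=1..m. s i)"
  unfolding speed_vectors_def by (auto intro!: sum_pos)

text \<open>An admissible \<open>\<alpha>\<close> is tested against two schedules only. Balanced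
  loads, at \<open>k = 1\<close>, cap every load by \<open>c = \<alpha> * P / \<Sigma>\<close>;
  running machine 1 alone, at \<open>k = m\<close>, caps the total load by
  \<open>c * \<Sigma> / s 1\<close>. Under these caps the work is at most
  \<open>\<alpha> * P / r\<close>, yet it must reach \<open>P\<close>.\<close>

lemma instance_ratio_ge:
  fixes s :: "nat \<Rightarrow> real"
  assumes m: "1 \<le> m" and s: "s \<in> speed_vectors m" and np: "(n, p) \<in> job_sets"
    and r: "0 < r"
    and knapsack: "\<And>L c. (\<And>i. i \<in> {1..m} \<Longrightarrow> 0 \<le> L i \<and> L i \<le> c) \<Longrightarrow>
      (\<Sum>i=1..m. L i) \<le> c * (\<Sum>i=1..m. s i) / s 1 \<Longrightarrow>
      (\<Sum>i=1..m. s i * L i) \<le> c * (\<Sum>i=1..m. s i) / r"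
  shows "ereal r \<le> instance_ratio m s n p"
  unfolding instance_ratio_def schedule_ratio_def
proof (intro INF_greatest Inf_greatest, clarify)
  fix S \<alpha>
  assume S: "S \<in> feasible_schedules m s n p"
    and opt: "\<forall>T\<in>feasible_schedules m s n p. loads m S \<preceq>\<^sub>s map ((*) \<alpha>) (loads m T)"
  define P where "P = (\<Sum>j=1..n. p j)"
  define \<Sigma> where "\<Sigma> = (\<Sum>i=1..m. s i)"
  define c where "c = \<alpha> * P / \<Sigma>"
  have P: "0 < P" using job_sets_total_pos[OF np] by (simp add: P_def)
  have \<Sigma>: "0 < \<Sigma>" using speed_sum_pos[OF s m] by (simp add: \<Sigma>_def)
  have s1: "0 < s 1" using s m by (auto simp: speed_vectors_def)
  have fin: "finite S" using S by (auto simp: feasible_schedules_def)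
  have len: "length (loads m R) = m" for R by (simp add: loads_def)
  have top: "top_sum k (loads m S) \<le> top_sum k (map ((*) \<alpha>) (loads m T))"
    if "T \<in> feasible_schedules m s n p" "k \<in> {1..m}" for T k
    using opt that by (auto simp: submajorized_iff len)
  obtain T where T: "T \<in> feasible_schedules m s n p" "loads m T = map (\<lambda>_. P / \<Sigma>) [1..<Suc m]"
  proof (rule exists_schedule_with_loads[OF np, where L = "\<lambda>_. P / \<Sigma>"])
    show "(\<Sum>i=1..m. s i * (P / \<Sigma>)) = (\<Sum>j=1..n. p j)"
      using \<Sigma> unfolding sum_distrib_right[symmetric] \<Sigma>_def[symmetric] P_def[symmetric] by simp
  qed (use P \<Sigma> in auto)
  have "top_sum 1 (map ((*) \<alpha>) (loads m T)) \<le> real 1 * c"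
    using m by (intro top_sum_le_bound) (auto simp: T(2) c_def)
  with top[OF T(1), of 1] m have "top_sum 1 (loads m S) \<le> c" by simp
  then have each: "0 \<le> load S i \<and> load S i \<le> c" if "i \<in> {1..m}" for i
    using that le_top_sum_1[of "load S i" "loads m S"] load_nonneg[OF fin, of i]
    by (force simp: loads_def simp del: upt_Suc)
  obtain U where U: "U \<in> feasible_schedules m s n p"
    "loads m U = map (\<lambda>i. if i = 1 then P / s 1 else 0) [1..<Suc m]"
  proof (rule exists_schedule_with_loads[OF np, where L = "\<lambda>i. if i = 1 then P / s 1 else 0"])
    show "(\<Sum>i=1..m. s i * (if i = 1 then P / s 1 else 0)) = (\<Sum>j=1..n. p j)"
      using s1 m by (simp add: if_distrib P_def cong: if_cong)
  qed (use P s1 in auto)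
  \<comment> \<open>At \<open>k = m\<close> the prefix is the whole list, so sorting has no effect
    and \<open>\<alpha>\<close> factors out.\<close>
  have "(\<Sum>i=1..m. load S i) = top_sum m (loads m S)"
    using top_sum_length[of "loads m S"] unfolding len by (simp only: loads_def sum_list_map_upt)
  also have "\<dots> \<le> top_sum m (map ((*) \<alpha>) (loads m U))"
    using m by (intro top U) simp
  also have "\<dots> = sum_list (map ((*) \<alpha>) (loads m U))"
    using top_sum_length[of "map ((*) \<alpha>) (loads m U)"] by (simp add: len)
  also have "\<dots> = \<alpha> * P / s 1"
    unfolding U(2) map_map comp_def sum_list_map_upt using m by (simp add: if_distrib cong: if_cong)
  also have "\<dots> = c * \<Sigma> / s 1" using \<Sigma> by (simp add: c_def)
  finally have "(\<Sum>i=1..m. load S i) \<le> c * \<Sigma> / s 1" .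
  with each have "(\<Sum>i=1..m. s i * load S i) \<le> c * \<Sigma> / r"
    unfolding \<Sigma>_def by (intro knapsack) auto
  with work_le_loads[OF S s] have "P \<le> \<alpha> * P / r" using \<Sigma> by (simp add: P_def c_def)
  then show "ereal r \<le> ereal \<alpha>" using P r by (simp add: field_simps)
qed

text \<open>Here \<open>y\<close> is a filling of the knapsack with unit cap, and
  \<open>y_work\<close> says that its value is large enough. Loads proportional to \<open>y\<close>
  satisfy both caps for \<open>c \<le> r * P / \<Sigma>\<close>, and these match the lower bounds
  valid for every competing schedule scaled by \<open>r\<close>.\<close>

lemma instance_ratio_le:
  fixes s y :: "nat \<Rightarrow> real"
  assumes m: "1 \<le> m" and s: "s \<in> speed_vectors m" and np: "(n, p) \<in> job_sets"
    and r: "0 < r" and M: "\<And>i. i \<in> {1..m} \<Longrightarrow> s i \<le> M"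
    and y: "\<And>i. i \<in> {1..m} \<Longrightarrow> 0 \<le> y i \<and> y i \<le> 1"
    and y_sum: "(\<Sum>i=1..m. y i) \<le> (\<Sum>i=1..m. s i) / M"
    and y_work: "(\<Sum>i=1..m. s i) / r \<le> (\<Sum>i=1..m. s i * y i)"
  shows "instance_ratio m s n p \<le> ereal r"
proof -
  define P where "P = (\<Sum>j=1..n. p j)"
  define \<Sigma> where "\<Sigma> = (\<Sum>i=1..m. s i)"
  define W where "W = (\<Sum>i=1..m. s i * y i)"
  have P: "0 < P" using job_sets_total_pos[OF np] by (simp add: P_def)
  have \<Sigma>: "0 < \<Sigma>" using speed_sum_pos[OF s m] by (simp add: \<Sigma>_def)
  have W: "\<Sigma> / r \<le> W" using y_work by (simp add: W_def \<Sigma>_def)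
  then have W0: "0 < W" using \<Sigma> r by (smt (verit) divide_pos_pos)
  have s0: "0 < s i" if "i \<in> {1..m}" for i using s that by (auto simp: speed_vectors_def)
  have M0: "0 < M" using s0[of 1] M[of 1] m by auto
  \<comment> \<open>With this factor the loads \<open>c * y i\<close> perform exactly the work
    \<open>P\<close>.\<close>
  define c where "c = P / W"
  have c0: "0 < c" using P W0 by (simp add: c_def)
  have c: "c \<le> r * P / \<Sigma>" using W W0 P \<Sigma> r by (simp add: c_def field_simps)
  obtain S where S: "S \<in> feasible_schedules m s n p" "loads m S = map (\<lambda>i. c * y i) [1..<Suc m]"
  proof (rule exists_schedule_with_loads[OF np, where L = "\<lambda>i. c * y i"])
    have "(\<Sum>i=1..m. s i * (c * y i)) = c * W"
      unfolding W_def sum_distrib_left by (simp add: mult_ac)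
    then show "(\<Sum>i=1..m. s i * (c * y i)) = (\<Sum>j=1..n. p j)"
      using W0 by (simp add: c_def P_def)
  qed (use c0 y in auto)
  have "loads m S \<preceq>\<^sub>s map ((*) r) (loads m T)" if T: "T \<in> feasible_schedules m s n p" for T
  proof -
    let ?Y = "map ((*) r) (loads m T)"
    have fin: "finite T" using T by (auto simp: feasible_schedules_def)
    have Y: "?Y = map (\<lambda>i. r * load T i) [1..<Suc m]" by (simp add: loads_def comp_def)
    have "top_sum k (loads m S) \<le> top_sum k ?Y" if k: "1 \<le> k" "k \<le> m" for k
    proof -
      define A where "A = top_sum k ?Y"
      have "r * P \<le> r * (\<Sum>i=1..m. s i * load T i)"
        using work_le_loads[OF T s] r by (simp add: P_def)
      also have "\<dots> = (\<Sum>i=1..m. s i * (r * load T i))"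
        by (simp add: sum_distrib_left mult_ac)
      also have "\<dots> \<le> A * max (\<Sigma> / real k) M"
        unfolding A_def Y \<Sigma>_def using k s0 M r load_nonneg[OF fin]
        by (intro weighted_sum_le_top_sum) (auto simp: less_imp_le)
      finally have work: "r * P \<le> A * max (\<Sigma> / real k) M" .
      \<comment> \<open>If \<open>\<Sigma> / real k\<close> attains the maximum, the cap on single
        loads suffices; otherwise the cap on the total load does.\<close>
      show ?thesis
      proof (cases "M \<le> \<Sigma> / real k")
        case True
        have "top_sum k (loads m S) \<le> real k * c"
          using k y c0 by (intro top_sum_le_bound) (auto simp: S(2) mult_le_cancel_left1)
        also have "\<dots> \<le> real k * (r * P / \<Sigma>)" using c by (intro mult_left_mono) auto
        also have "\<dots> \<le> A" using work True k \<Sigma> by (simp add: max_def field_simps split: if_splits)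
        finally show ?thesis unfolding A_def .
      next
        case False
        have "top_sum k (loads m S) \<le> sum_list (loads m S)"
          using y c0 by (intro top_sum_le_sum_list) (auto simp: S(2))
        also have "\<dots> = c * (\<Sum>i=1..m. y i)"
          unfolding S(2) sum_list_map_upt sum_distrib_left ..
        also have "\<dots> \<le> (r * P / \<Sigma>) * (\<Sigma> / M)"
          using c y_sum c0 y r P \<Sigma> by (intro mult_mono) (auto simp: \<Sigma>_def intro!: sum_nonneg)
        also have "\<dots> \<le> A" using work False \<Sigma> M0 by (simp add: max_def field_simps)
        finally show ?thesis unfolding A_def .
      qed
    qed
    then show ?thesis by (subst submajorized_iff) (auto simp: loads_def)
  qed
  then have "schedule_ratio m s n p S \<le> ereal r"
    unfolding schedule_ratio_def by (intro Inf_lower) auto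
  then show ?thesis unfolding instance_ratio_def by (rule INF_lower2[OF S(1)])
qed

text \<open>The lower bound is asked for at one worst speed vector and there for all job sets; a
  single unit job then witnesses the supremum.\<close>

lemma WAR_eqI:
  assumes "\<And>s n p. s \<in> V \<Longrightarrow> (n, p) \<in> job_sets \<Longrightarrow> instance_ratio m s n p \<le> r"
    and "s \<in> V" and "\<And>n p. (n, p) \<in> job_sets \<Longrightarrow> r \<le> instance_ratio m s n p"
  shows "WAR m V = r"
proof (rule antisym)
  show "WAR m V \<le> r" unfolding WAR_def using assms(1) by (auto intro!: SUP_least)
  have job: "(1, \<lambda>_. 1) \<in> job_sets" by (simp add: job_sets_def)
  then show "r \<le> WAR m V" unfolding WAR_def
    using assms(2) assms(3)[OF job] by (intro SUP_upper2[of "(s, 1, \<lambda>_. 1)"]) auto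
qed

section \<open>Fixed speeds\<close>

text \<open>With unit cap the knapsack has capacity \<open>t + \<Delta>\<close>. Its greedy filling
  takes machines 1 to \<open>t\<close> fully and the fraction \<open>\<Delta>\<close> of the next
  one, with value \<open>W\<close>; optimality follows by pricing the capacity at
  \<open>s (t + 1)\<close>.\<close>

lemma WAR_fixed_speeds:
  fixes s :: "nat \<Rightarrow> real"
  assumes s: "s \<in> speed_vectors m" and mono: "antimono_on {1..m} s" and s_last: "s (m + 1) = 0"
    and t: "1 \<le> t" "t \<le> m" and \<Delta>: "0 \<le> \<Delta>" "\<Delta> < 1"
    and sum: "(\<Sum>i=1..m. s i) / s 1 = real t + \<Delta>"
  shows "WAR m {s} = ereal ((\<Sum>i=1..m. s i) / ((\<Sum>i=1..t. s i) + \<Delta> * s (t + 1)))"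
proof -
  define \<Sigma> where "\<Sigma> = (\<Sum>i=1..m. s i)"
  define W where "W = (\<Sum>i=1..t. s i) + \<Delta> * s (t + 1)"
  have m: "1 \<le> m" using t by simp
  have s0: "0 < s i" if "i \<in> {1..m}" for i using s that by (auto simp: speed_vectors_def)
  have \<Sigma>: "0 < \<Sigma>" using speed_sum_pos[OF s m] by (simp add: \<Sigma>_def)
  have st: "0 \<le> s (t + 1)" using s0[of "t + 1"] s_last t by (cases "t = m") auto
  have W0: "0 < W" unfolding W_def using s0 t \<Delta> st by (intro add_pos_nonneg sum_pos) auto
  have anti: "s j \<le> s i" if "1 \<le> i" "i \<le> j" "j \<le> m" for i j
    using mono that by (auto simp: monotone_on_def)
  have before: "s (t + 1) \<le> s i" if "1 \<le> i" "i \<le> t" for i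
    using anti[of i "t + 1"] s0[of i] s_last that t by (cases "t = m") auto
  have split: "(\<Sum>i=1..m. f i) = (\<Sum>i=1..t. f i) + (\<Sum>i=t+1..m. f i)" for f :: "nat \<Rightarrow> real"
    using t sum.ub_add_nat[of 1 t f "m - t"] by simp
  have s1: "0 < s 1" using s0[of 1] m by simp
  \<comment> \<open>For \<open>t = m\<close> there is no machine \<open>t + 1\<close> to take the
    fraction. Speeds of at most \<open>s 1\<close> sum to at most \<open>m * s 1\<close>, which
    leaves no fraction.\<close>
  have \<Delta>_last: "\<Delta> = 0" if "t = m"
  proof -
    have "\<Sigma> \<le> (\<Sum>i=1..m. s 1)" unfolding \<Sigma>_def using anti[of 1] by (intro sum_mono) auto
    moreover have "\<Sigma> = (real m + \<Delta>) * s 1" using sum s1 that by (simp add: \<Sigma>_def field_simps)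
    ultimately show ?thesis using s1 \<Delta> by (simp add: algebra_simps mult_le_0_iff)
  qed
  have lower: "ereal (\<Sigma> / W) \<le> instance_ratio m s n p" if "(n, p) \<in> job_sets" for n p
  proof (rule instance_ratio_ge[OF m s that])
    show "0 < \<Sigma> / W" using \<Sigma> W0 by simp
  next
    fix L c
    assume L: "\<And>i. i \<in> {1..m} \<Longrightarrow> 0 \<le> L i \<and> L i \<le> c"
      and "(\<Sum>i=1..m. L i) \<le> c * (\<Sum>i=1..m. s i) / s 1"
    then have tot: "(\<Sum>i=1..m. L i) \<le> c * (real t + \<Delta>)" using sum by (simp flip: sum)
    \<comment> \<open>The reduced speeds are nonnegative up to \<open>t\<close>, where
      \<open>L i \<le> c\<close> is used, and nonpositive after it, where \<open>0 \<le> L i\<close>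
      is used. The part subtracted is \<open>s (t + 1)\<close> times the total load, which
      \<open>tot\<close> bounds.\<close>
    let ?d = "\<lambda>i. s i - s (t + 1)"
    have "(\<Sum>i=1..m. ?d i * L i) = (\<Sum>i=1..t. ?d i * L i) + (\<Sum>i=t+1..m. ?d i * L i)"
      by (rule split)
    also have "\<dots> \<le> (\<Sum>i=1..t. ?d i * c) + 0"
    proof (rule add_mono)
      show "(\<Sum>i=1..t. ?d i * L i) \<le> (\<Sum>i=1..t. ?d i * c)"
        using before L t by (intro sum_mono mult_left_mono) auto
      show "(\<Sum>i=t+1..m. ?d i * L i) \<le> 0"
        using anti[of "t + 1"] L by (intro sum_nonpos) (auto simp: mult_le_0_iff)
    qed
    also have "\<dots> = c * (\<Sum>i=1..t. s i) - c * real t * s (t + 1)"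
      by (simp add: sum_subtractf flip: sum_distrib_right) (simp add: algebra_simps)
    finally have "(\<Sum>i=1..m. s i * L i) \<le>
        c * (\<Sum>i=1..t. s i) - c * real t * s (t + 1) + s (t + 1) * (\<Sum>i=1..m. L i)"
      by (simp add: left_diff_distrib sum_subtractf sum_distrib_left)
    also have "\<dots> \<le> c * W"
      using mult_left_mono[OF tot st] by (simp add: W_def algebra_simps)
    finally show "(\<Sum>i=1..m. s i * L i) \<le> c * (\<Sum>i=1..m. s i) / (\<Sigma> / W)"
      using \<Sigma> unfolding \<Sigma>_def[symmetric] by simp
  qed
  have upper: "instance_ratio m s n p \<le> ereal (\<Sigma> / W)" if "(n, p) \<in> job_sets" for n p
  proof -
    define y where "y i = (if i \<le> t then 1 else if i = t + 1 then \<Delta> else 0)" for i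
    have y: "(\<Sum>i=1..m. f i * y i) = (\<Sum>i=1..t. f i) + \<Delta> * f (t + 1)" for f :: "nat \<Rightarrow> real"
    proof -
      have "(\<Sum>i=1..t. f i * y i) = (\<Sum>i=1..t. f i)" by (simp add: y_def)
      moreover have "(\<Sum>i=t+1..m. f i * y i) = (\<Sum>i=t+1..m. if i = t + 1 then \<Delta> * f (t + 1) else 0)"
        by (intro sum.cong) (auto simp: y_def)
      ultimately show ?thesis using \<Delta>_last t by (subst split) auto
    qed
    show ?thesis
    proof (rule instance_ratio_le[OF m s that, where y = y and M = "s 1"])
      show "0 < \<Sigma> / W" using \<Sigma> W0 by simp
      show "s i \<le> s 1" if "i \<in> {1..m}" for i using anti[of 1 i] that by simp
      show "0 \<le> y i \<and> y i \<le> 1" for i using \<Delta> by (simp add: y_def)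
      show "(\<Sum>i=1..m. y i) \<le> (\<Sum>i=1..m. s i) / s 1" using y[of "\<lambda>_. 1"] sum by simp
      show "(\<Sum>i=1..m. s i) / (\<Sigma> / W) \<le> (\<Sum>i=1..m. s i * y i)"
        using \<Sigma> unfolding y W_def[symmetric] \<Sigma>_def[symmetric] by simp
    qed
  qed
  from lower upper have "WAR m {s} = ereal (\<Sigma> / W)" by (intro WAR_eqI[where s = s]) auto
  then show ?thesis by (simp add: \<Sigma>_def W_def)
qed

section \<open>Speeds as part of the input\<close>

text \<open>The tangent inequality at \<open>b = a * M\<close> is applied to every index but
  \<open>i0\<close>, whose square is kept exactly. The value of \<open>a\<close> solves
  \<open>1 - 2 * a = (m - 1) * a\<^sup>2\<close>, so all multiples of \<open>M * M\<close> cancel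
  and \<open>2 * b\<close> times the sum remains.\<close>

lemma sum_squares_ge:
  fixes s :: "nat \<Rightarrow> real"
  assumes i0: "i0 \<in> {1..m}"
  shows "2 / (sqrt (real m) + 1) * (s i0 * (\<Sum>i=1..m. s i)) \<le> (\<Sum>i=1..m. s i * s i)"
proof -
  define M where "M = s i0"
  define a where "a = 1 / (sqrt (real m) + 1)"
  define b where "b = a * M"
  let ?R = "{1..m} - {i0}"
  have sq: "0 < sqrt (real m) + 1" by (smt (verit) real_sqrt_ge_zero of_nat_0_le_iff)
  have a: "1 - 2 * a = (real m - 1) * a\<^sup>2"
  proof -
    have "real m - 1 = (sqrt (real m) + 1) * (sqrt (real m) - 1)" by (simp add: algebra_simps)
    moreover have "(sqrt (real m) + 1) * a = 1" using sq by (simp add: a_def)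
    ultimately show ?thesis by algebra
  qed
  have "(\<Sum>i\<in>?R. 2 * b * s i - b\<^sup>2) \<le> (\<Sum>i\<in>?R. s i * s i)"
  proof (rule sum_mono)
    fix i
    have "0 \<le> (s i - b)\<^sup>2" by simp
    then show "2 * b * s i - b\<^sup>2 \<le> s i * s i" by (simp add: power2_eq_square algebra_simps)
  qed
  moreover have "(\<Sum>i\<in>?R. 2 * b * s i - b\<^sup>2) = 2 * b * ((\<Sum>i=1..m. s i) - M) - (real m - 1) * b\<^sup>2"
    using i0 by (simp add: sum_subtractf sum_distrib_left[symmetric] sum_diff1 M_def of_nat_diff)
  moreover have "(\<Sum>i=1..m. s i * s i) = M * M + (\<Sum>i\<in>?R. s i * s i)"
    using i0 by (simp add: sum.remove M_def)
  moreover have "(real m - 1) * b\<^sup>2 = (1 - 2 * a) * (M * M)"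
    unfolding a by (simp add: b_def power2_eq_square)
  ultimately have "2 * b * (\<Sum>i=1..m. s i) \<le> (\<Sum>i=1..m. s i * s i)"
    by (simp add: b_def algebra_simps)
  then show ?thesis by (simp add: b_def a_def M_def mult_ac)
qed

text \<open>For the upper bound the filling is \<open>u i\<close> divided by the largest speed, and
  \<open>sum_squares_ge\<close> estimates its value. The lower bound uses the equality case of that
  estimate, one machine of speed 1 and all others of speed \<open>a\<close>.\<close>

lemma WAR_variable_speeds:
  assumes m: "1 \<le> m"
  shows "WAR m (speed_vectors m) = ereal ((sqrt (real m) + 1) / 2)"
proof -
  define q where "q = sqrt (real m)"
  have q: "1 \<le> q" "q * q = real m" using m by (simp_all add: q_def)
  define a where "a = 1 / (q + 1)"
  define s where "s i = (if i = 1 then 1 else a)" for i :: nat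
  have a: "0 < a" "a \<le> 1" using q by (simp_all add: a_def)
  have s: "s \<in> speed_vectors m" using a by (auto simp: speed_vectors_def s_def)
  have s_eq: "s i = a + (1 - a) * (if i = 1 then 1 else 0)" for i by (simp add: s_def)
  have "(\<Sum>i=1..m. s i) = real m * a + (1 - a)"
    unfolding s_eq sum.distrib sum_distrib_left[symmetric] using m by simp
  also have "\<dots> = q"
    using q by (simp add: a_def field_simps)
  finally have \<Sigma>: "(\<Sum>i=1..m. s i) = q" .
  have lower: "ereal ((q + 1) / 2) \<le> instance_ratio m s n p" if "(n, p) \<in> job_sets" for n p
  proof (rule instance_ratio_ge[OF m s that])
    show "0 < (q + 1) / 2" using q by simp
  next
    fix L c
    assume L: "\<And>i. i \<in> {1..m} \<Longrightarrow> 0 \<le> L i \<and> L i \<le> c"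
      and tot: "(\<Sum>i=1..m. L i) \<le> c * (\<Sum>i=1..m. s i) / s 1"
    \<comment> \<open>The total load is priced at \<open>a\<close> and machine 1 at the surplus
      \<open>1 - a\<close>, so that each of the two caps is used once.\<close>
    have "(\<Sum>i=1..m. s i * L i) = (\<Sum>i=1..m. a * L i + (if i = 1 then (1 - a) * L 1 else 0))"
      by (intro sum.cong) (auto simp: s_def algebra_simps)
    also have "\<dots> = a * (\<Sum>i=1..m. L i) + (1 - a) * L 1"
      using m by (simp add: sum.distrib sum_distrib_left)
    also have "\<dots> \<le> a * (c * q) + (1 - a) * c"
      using tot[unfolded \<Sigma>] L[of 1] m a
      by (intro add_mono mult_left_mono) (auto simp: s_def[of 1] s_def[of "Suc 0"])
    also have "\<dots> = c * q / ((q + 1) / 2)" using q by (simp add: a_def field_simps)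
    finally show "(\<Sum>i=1..m. s i * L i) \<le> c * (\<Sum>i=1..m. s i) / ((q + 1) / 2)"
      unfolding \<Sigma> .
  qed
  have upper: "instance_ratio m u n p \<le> ereal ((q + 1) / 2)"
    if u: "u \<in> speed_vectors m" and np: "(n, p) \<in> job_sets" for u n p
  proof -
    \<comment> \<open>Speed vectors in the input need not be sorted, so the fastest machine
      \<open>i0\<close> is selected through the maximum.\<close>
    have "Max (u ` {1..m}) \<in> u ` {1..m}" using m by (intro Max_in) auto
    then obtain i0 where i0: "i0 \<in> {1..m}" "Max (u ` {1..m}) = u i0" by auto
    then have max: "u i \<le> u i0" if "i \<in> {1..m}" for i
      using that by (metis Max_ge finite_atLeastAtMost finite_imageI imageI)
    have u0: "0 < u i" if "i \<in> {1..m}" for i using u that by (auto simp: speed_vectors_def)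
    show ?thesis
    proof (rule instance_ratio_le[OF m u np _ max, where y = "\<lambda>i. u i / u i0"])
      show "0 < (q + 1) / 2" using q by simp
      show "0 \<le> u i / u i0 \<and> u i / u i0 \<le> 1" if "i \<in> {1..m}" for i
        using max[OF that] u0[OF that] by simp
      show "(\<Sum>i=1..m. u i / u i0) \<le> (\<Sum>i=1..m. u i) / u i0" by (simp add: sum_divide_distrib)
      have "(\<Sum>i=1..m. u i) / ((q + 1) / 2) = 2 / (q + 1) * (u i0 * (\<Sum>i=1..m. u i)) / u i0"
        using u0[OF i0(1)] by simp
      also have "\<dots> \<le> (\<Sum>i=1..m. u i * u i) / u i0"
        using sum_squares_ge[OF i0(1), of u] u0[OF i0(1)] unfolding q_def
        by (intro divide_right_mono) auto
      finally show "(\<Sum>i=1..m. u i) / ((q + 1) / 2) \<le> (\<Sum>i=1..m. u i * (u i / u i0))"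
        by (simp add: sum_divide_distrib)
    qed
  qed
  from lower upper s have "WAR m (speed_vectors m) = ereal ((q + 1) / 2)"
    by (intro WAR_eqI[where s = s]) auto
  then show ?thesis by (simp add: q_def)
qed

theorem theorem9:
  fixes m :: nat
  assumes "1 \<le> m"
  shows "(\<forall>(s :: nat \<Rightarrow> real) (t :: nat) (\<Delta> :: real).
            s \<in> speed_vectors m \<and> antimono_on {1..m} s \<and> s (m + 1) = 0 \<and>
            1 \<le> t \<and> t \<le> m \<and> 0 \<le> \<Delta> \<and> \<Delta> < 1 \<and>
            (\<Sum>i=1..m. s i) / s 1 = real t + \<Delta> \<longrightarrow>
            WAR m {s} = ereal ((\<Sum>i=1..m. s i) / ((\<Sum>i=1..t. s i) + \<Delta> * s (t + 1)))) \<and>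
         WAR m (speed_vectors m) = ereal ((sqrt (real m) + 1) / 2)"
proof (intro conjI allI impI)
  show "WAR m {s} = ereal ((\<Sum>i=1..m. s i) / ((\<Sum>i=1..t. s i) + \<Delta> * s (t + 1)))"
    if "s \<in> speed_vectors m \<and> antimono_on {1..m} s \<and> s (m + 1) = 0 \<and>
            1 \<le> t \<and> t \<le> m \<and> 0 \<le> \<Delta> \<and> \<Delta> < 1 \<and>
            (\<Sum>i=1..m. s i) / s 1 = real t + \<Delta>" for s t \<Delta>
    using that by (elim conjE) (rule WAR_fixed_speeds)
qed (rule WAR_variable_speeds[OF assms])

end
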